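(* Let $f:\mathbf{R}^n\to[0,\infty)$ be a log-concave function. Then $$\int_{\mathbf{R}^n}\Delta f(z)\,dz\le 2^n\int_{\mathbf{R}^n}f(x)\,dx .$$
   Context: A function $f:\mathbf{R}^n\to[0,\infty)$ is log-concave if $f((1-t)x+ty)\ge f(x)^{1-t}f(y)^t$ for all $x,y\in\mathbf{R}^n$ and all $t\in[0,1]$. The difference function of a nonnegative function $f$ is $$\Delta f(z)=\sup\left\{\sqrt{f(x)f(-y)}\;:\;x,y\in\mathbf{R}^n,\ \tfrac12(x+y)=z\right\},\quad z\in\mathbf{R}^n,$$ with values in $[0,\infty]$. Integrals are with respect to Lebesgue measure and take values in $[0,\infty]$. *)

theory Defs
  imports "HOL-Analysis.Analysis"
begin

text \<open>
  The library convention \<open>0 powr 0 = 0\<close> is harmless below: it only matters for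
  \<open>t = 0\<close> and \<open>t = 1\<close>, where the inequality holds trivially for nonnegative \<open>f\<close>
  under either convention for \<open>0\<^sup>0\<close>.
\<close>

definition log_concave :: "('a::real_vector \<Rightarrow> real) \<Rightarrow> bool" where
  "log_concave f \<longleftrightarrow>
     (\<forall>x. 0 \<le> f x) \<and>
     (\<forall>x y. \<forall>t\<in>{0..1}. f ((1 - t) *\<^sub>R x + t *\<^sub>R y) \<ge> f x powr (1 - t) * f y powr t)"

text \<open>The supremum may be infinite, hence the values in \<open>ennreal\<close>.\<close>

definition difference_function :: "('a::real_vector \<Rightarrow> real) \<Rightarrow> 'a \<Rightarrow> ennreal" where
  "difference_function f z =
     Sup {ennreal (sqrt (f x * f (- y))) | x y. (1 / 2) *\<^sub>R (x + y) = z}"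

end

theory Submission imports Defs begin

text \<open>
  If \<open>z = (x + y) / 2\<close>, log-concavity on the segments from \<open>v\<close> to \<open>x\<close> and from \<open>v\<close> to \<open>- y\<close>
  gives, at \<open>u = (v + x) / 2\<close>, the bound \<open>f u * f (u - z) \<ge> f v * sqrt (f x * f (- y))\<close>.
  Integrating in \<open>v\<close> yields \<open>\<integral> f u * f (u - z) du \<ge> 2\<^sup>-\<^sup>n * \<integral>f * \<Delta>f z\<close>; integrating in \<open>z\<close>
  turns the left-hand side into \<open>(\<integral>f)\<^sup>2\<close>, and one divides by \<open>\<integral>f\<close>.
  If \<open>\<integral>f = 0\<close>, the convex set \<open>{f > 0}\<close> lies in a hyperplane \<open>a \<bullet> x = b\<close>, so \<open>\<Delta>f\<close> vanishes off
  the null set \<open>a \<bullet> z = 0\<close>.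
\<close>

text \<open>The interior is open and the rest of \<open>S\<close> lies in the frontier, which is
  negligible for a convex set. Borel would be too much to ask: in dimension at least 2, an open ball
  together with any part of its bounding sphere is convex.\<close>

lemma convex_imp_sets_lebesgue:
  fixes S :: "'a::euclidean_space set"
  assumes "convex S"
  shows "S \<in> sets lebesgue"
proof -
  have "S \<inter> frontier S \<in> sets lebesgue"
    by (meson assms inf_le2 negligible_convex_frontier negligible_imp_sets negligible_subset)
  moreover have "interior S \<in> sets lebesgue"
    by simp
  moreover have "S = interior S \<union> (S \<inter> frontier S)"
    using interior_subset closure_subset by (auto simp: frontier_def)
  ultimately show ?thesis
    by (metis sets.Un)
qed

text \<open>A weighted geometric mean of two numbers above \<open>a\<close> is again above
  \<open>a\<close>. All levels together give measurability of \<open>f\<close>; level 0 serves the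
  case of integral zero.\<close>

lemma log_concave_convex_superlevel:
  assumes "log_concave f"
  shows "convex {x. a < f x}"
  unfolding convex_alt
proof (clarsimp)
  fix x y and t :: real
  assume xy: "a < f x" "a < f y" and t: "0 \<le> t" "t \<le> 1"
  have nonneg: "0 \<le> f w" for w
    using assms by (simp add: log_concave_def)
  have le: "f x powr (1 - t) * f y powr t \<le> f ((1 - t) *\<^sub>R x + t *\<^sub>R y)"
    using assms t by (auto simp: log_concave_def)
  \<comment> \<open>Strict monotonicity of \<open>powr\<close> in the base needs positive exponents
    and \<open>0 \<le> a\<close>, so the endpoints and negative levels are split off.\<close>
  consider "t = 0" | "t = 1" | "a < 0" | "0 < t" "t < 1" "0 \<le> a"
    using t by linarith
  then show "a < f ((1 - t) *\<^sub>R x + t *\<^sub>R y)"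
  proof cases
    case 3
    then show ?thesis
      using nonneg order_less_le_trans by blast
  next
    case 4
    have "a = a powr (1 - t) * a powr t"
      using 4 by (cases "a = 0") (auto simp flip: powr_add)
    also have "\<dots> < f x powr (1 - t) * f y powr t"
      using 4 xy by (intro mult_strict_mono' powr_less_mono2) auto
    finally show ?thesis
      using le by simp
  qed (use xy in auto)
qed

lemma log_concave_borel_measurable_lebesgue:
  fixes f :: "'a::euclidean_space \<Rightarrow> real"
  assumes "log_concave f"
  shows "f \<in> borel_measurable lebesgue"
  unfolding borel_measurable_iff_greater
  using convex_imp_sets_lebesgue[OF log_concave_convex_superlevel[OF assms]] by simp

lemma log_concave_midpoint:
  assumes "log_concave f"
  shows "sqrt (f x * f y) \<le> f ((1 / 2) *\<^sub>R (x + y))"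
proof -
  have "(1 / 2 :: real) \<in> {0..1}"
    by simp
  then have "f x powr (1 - 1 / 2) * f y powr (1 / 2)
      \<le> f ((1 - 1 / 2) *\<^sub>R x + (1 / 2) *\<^sub>R y)"
    using assms unfolding log_concave_def by blast
  moreover have "0 \<le> f x" "0 \<le> f y"
    using assms by (auto simp: log_concave_def)
  ultimately show ?thesis
    by (simp add: powr_half_sqrt real_sqrt_mult scaleR_add_right)
qed

lemma nn_integral_lborel_affine:
  fixes t :: "'a::euclidean_space"
  assumes [measurable]: "F \<in> borel_measurable borel" and "c \<noteq> 0"
  shows "(\<integral>\<^sup>+ x. F x \<partial>lborel)
    = ennreal (\<bar>c\<bar> ^ DIM('a)) * (\<integral>\<^sup>+ x. F (t + c *\<^sub>R x) \<partial>lborel)"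
  by (subst lborel_affine[OF \<open>c \<noteq> 0\<close>, of t])
     (simp add: nn_integral_density nn_integral_distr nn_integral_cmult)

text \<open>Nonsingular affine maps pull null sets back to null sets; this carries an almost
  everywhere equality over to midpoints with one end fixed.\<close>

lemma AE_lborel_affine:
  fixes t :: "'a::euclidean_space"
  assumes "AE x in lborel. P x" "c \<noteq> 0"
  shows "AE x in lborel. P (t + c *\<^sub>R x)"
proof -
  have "AE x in density (distr lborel borel (\<lambda>x. t + c *\<^sub>R x)) (\<lambda>_. \<bar>c\<bar> ^ DIM('a)). P x"
    by (simp only: lborel_affine[OF assms(2), of t, symmetric] assms(1))
  then have "AE x in distr lborel borel (\<lambda>x. t + c *\<^sub>R x). P x"
    using \<open>c \<noteq> 0\<close> by (subst (asm) AE_density) auto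
  then show ?thesis
    by (rule AE_distrD[rotated]) simp
qed

text \<open>The Borel version \<open>g\<close> makes substitution and Fubini available. The supremum
  can change when \<open>f\<close> is altered on a null set, so \<open>difference_function\<close>
  keeps \<open>f\<close> itself.\<close>

lemma difference_function_le_autocorrelation:
  fixes f g :: "'a::euclidean_space \<Rightarrow> real"
  assumes f: "log_concave f"
    and g [measurable]: "g \<in> borel_measurable borel" and fg: "AE x in lborel. f x = g x"
  shows "(\<integral>\<^sup>+ x. g x \<partial>lborel) * difference_function f z
    \<le> 2 ^ DIM('a) * (\<integral>\<^sup>+ u. ennreal (g u) * ennreal (g (u - z)) \<partial>lborel)"
    (is "?I * _ \<le> _ * ?G")
proof -
  have nonneg: "0 \<le> f w" for w
    using f by (simp add: log_concave_def)
  have "?I * s \<le> 2 ^ DIM('a) * ?G"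
    if "s \<in> {ennreal (sqrt (f x * f (- y))) | x y. (1 / 2) *\<^sub>R (x + y) = z}" for s
  proof -
    from that obtain x y where s: "s = ennreal (sqrt (f x * f (- y)))"
      and z: "z = (1 / 2) *\<^sub>R (x + y)"
      by auto
    define u where "u v = (1 / 2) *\<^sub>R x + (1 / 2) *\<^sub>R v" for v
    \<comment> \<open>As \<open>z\<close> is the midpoint of \<open>x\<close> and \<open>y\<close>,
      subtracting it from the midpoint of \<open>x\<close> and \<open>v\<close> leaves the midpoint
      of \<open>v\<close> and \<open>- y\<close>.\<close>
    have u_z: "u v - z = (- (1 / 2) *\<^sub>R y) + (1 / 2) *\<^sub>R v" for v
      by (simp add: u_def z scaleR_add_right)
    have pointwise: "f v * sqrt (f x * f (- y)) \<le> f (u v) * f (u v - z)" for v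
    proof -
      have "f v * sqrt (f x * f (- y)) = sqrt (f v * f x) * sqrt (f v * f (- y))"
        using nonneg[of v] by (simp add: real_sqrt_mult)
      also have "\<dots> \<le> f (u v) * f (u v - z)"
        using log_concave_midpoint[OF f, of v x] log_concave_midpoint[OF f, of v "- y"] nonneg
        by (intro mult_mono) (simp_all add: u_z, simp_all add: u_def scaleR_add_right
            scaleR_diff_right add.commute)
      finally show ?thesis .
    qed
    have "AE v in lborel. f (u v) = g (u v)" "AE v in lborel. f (u v - z) = g (u v - z)"
      unfolding u_z unfolding u_def using fg by (intro AE_lborel_affine; simp)+
    with fg have AE: "AE v in lborel. ennreal (g v) * s \<le> ennreal (g (u v)) * ennreal (g (u v - z))"
    proof eventually_elim
      case (elim v)
      have "ennreal (f v) * s = ennreal (f v * sqrt (f x * f (- y)))"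
        by (simp add: s ennreal_mult nonneg)
      also have "\<dots> \<le> ennreal (f (u v) * f (u v - z))"
        by (intro ennreal_leI pointwise)
      also have "\<dots> = ennreal (f (u v)) * ennreal (f (u v - z))"
        by (rule ennreal_mult[OF nonneg nonneg])
      finally show ?case
        by (simp only: elim)
    qed
    have "?I * s = (\<integral>\<^sup>+ v. ennreal (g v) * s \<partial>lborel)"
      by (simp add: nn_integral_multc)
    also have "\<dots> \<le> (\<integral>\<^sup>+ v. ennreal (g (u v)) * ennreal (g (u v - z)) \<partial>lborel)"
      by (intro nn_integral_mono_AE AE)
    \<comment> \<open>A factor 1 is inserted: \<open>(1 / 2) ^ DIM('a)\<close> is the Jacobian of
      \<open>u\<close>, absorbed by the substitution, and \<open>2 ^ DIM('a)\<close>
      remains.\<close>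
    also have "\<dots> = (2 ^ DIM('a) * ennreal ((1 / 2) ^ DIM('a))) *
        (\<integral>\<^sup>+ v. ennreal (g (u v)) * ennreal (g (u v - z)) \<partial>lborel)"
    proof -
      have "(2 :: ennreal) ^ DIM('a) = ennreal (2 ^ DIM('a))"
        by (simp flip: ennreal_power)
      then have "(2 :: ennreal) ^ DIM('a) * ennreal ((1 / 2) ^ DIM('a))
          = ennreal (2 ^ DIM('a) * (1 / 2) ^ DIM('a))"
        by (simp only: ennreal_mult zero_le_power zero_le_numeral zero_le_divide_1_iff)
      also have "\<dots> = 1"
        by (simp add: power_one_over)
      finally show ?thesis
        by (simp only: mult_1)
    qed
    also have "\<dots> = 2 ^ DIM('a) * ?G"
      unfolding u_def
      by (subst (2) nn_integral_lborel_affine[where c = "1 / 2" and t = "(1 / 2) *\<^sub>R x"])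
         (auto simp: mult.assoc)
    finally show ?thesis .
  qed
  then show ?thesis
    \<comment> \<open>Multiplication in \<open>ennreal\<close> commutes with suprema, so the bound
      for each single pair \<open>x\<close>, \<open>y\<close> suffices.\<close>
    unfolding difference_function_def SUP_mult_left_ennreal[of _ id, simplified]
    by (intro SUP_least) auto
qed

text \<open>After swapping the integrals, reflection and translation invariance make the inner
  integral over \<open>z\<close> independent of \<open>u\<close>.\<close>

lemma nn_integral_autocorrelation:
  fixes g :: "'a::euclidean_space \<Rightarrow> ennreal"
  assumes [measurable]: "g \<in> borel_measurable borel"
  shows "(\<integral>\<^sup>+ z. \<integral>\<^sup>+ u. g u * g (u - z) \<partial>lborel \<partial>lborel) = (\<integral>\<^sup>+ x. g x \<partial>lborel)\<^sup>2"
proof -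
  have reflect: "(\<integral>\<^sup>+ z. g (u - z) \<partial>lborel) = (\<integral>\<^sup>+ x. g x \<partial>lborel)" for u
    by (subst (2) nn_integral_lborel_affine[where c = "- 1" and t = u]) auto
  have "(\<integral>\<^sup>+ z. \<integral>\<^sup>+ u. g u * g (u - z) \<partial>lborel \<partial>lborel)
      = (\<integral>\<^sup>+ u. \<integral>\<^sup>+ z. g u * g (u - z) \<partial>lborel \<partial>lborel)"
    by (rule lborel_pair.Fubini') simp
  also have "\<dots> = (\<integral>\<^sup>+ x. g x \<partial>lborel)\<^sup>2"
    by (simp add: nn_integral_cmult reflect nn_integral_multc power2_eq_square)
  finally show ?thesis .
qed

lemma difference_function_AE_eq_0:
  fixes f :: "'a::euclidean_space \<Rightarrow> real"
  assumes f: "log_concave f" and "(\<integral>\<^sup>+ x. f x \<partial>lebesgue) = 0"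
  shows "AE z in lebesgue. difference_function f z = 0"
proof -
  have nonneg: "0 \<le> f w" for w
    using f by (simp add: log_concave_def)
  note [measurable] = log_concave_borel_measurable_lebesgue[OF f]
  have "AE x in lebesgue. ennreal (f x) = 0"
    using assms(2) by (subst (asm) nn_integral_0_iff_AE) auto
  then have "AE x in lebesgue. x \<notin> {x. 0 < f x}"
    by (rule AE_mp) (simp add: ennreal_eq_0_iff not_less)
  then have "negligible {x. 0 < f x}"
    unfolding negligible_iff_null_sets
    using log_concave_convex_superlevel[OF f] convex_imp_sets_lebesgue AE_iff_null_sets by blast
  then have "interior {x. 0 < f x} = {}"
    using negligible_convex_interior log_concave_convex_superlevel[OF f] by blast
  then obtain a b where a: "a \<noteq> 0" and ab: "{x. 0 < f x} \<subseteq> {x. a \<bullet> x = b}"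
    using empty_interior_subset_hyperplane log_concave_convex_superlevel[OF f] by metis
  have vanish: "difference_function f z = 0" if z: "a \<bullet> z \<noteq> 0" for z
  proof -
    have "s = 0" if "s \<in> {ennreal (sqrt (f x * f (- y))) | x y. (1 / 2) *\<^sub>R (x + y) = z}" for s
    proof (rule ccontr)
      assume "s \<noteq> 0"
      from that obtain x y where xy: "z = (1 / 2) *\<^sub>R (x + y)"
        and s: "s = ennreal (sqrt (f x * f (- y)))"
        by blast
      have "f x \<noteq> 0" "f (- y) \<noteq> 0"
        using \<open>s \<noteq> 0\<close> by (auto simp: s)
      \<comment> \<open>Both \<open>x\<close> and \<open>- y\<close> lie in the hyperplane, so
        \<open>a \<bullet> y = - b\<close> and the offset cancels in
        \<open>a \<bullet> z\<close>.\<close>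
      then have "a \<bullet> x = b" "a \<bullet> (- y) = b"
        using ab nonneg[of x] nonneg[of "- y"] by (auto simp: less_le)
      then show False
        using z by (simp add: xy inner_add_right)
    qed
    then show ?thesis
      unfolding difference_function_def by (metis (no_types, lifting) Sup_least le_zero_eq order_refl)
  qed
  have "{z. a \<bullet> z = 0} \<in> null_sets lebesgue"
    using a negligible_hyperplane[of a 0] by (simp add: negligible_iff_null_sets)
  then have "AE z in lebesgue. z \<notin> {z. a \<bullet> z = 0}"
    by (rule AE_not_in)
  then show ?thesis
    by (rule AE_mp) (simp add: vanish)
qed

lemma nn_integral_difference_function_le:
  fixes f :: "'a::euclidean_space \<Rightarrow> real"
  assumes f: "log_concave f"
  shows "(\<integral>\<^sup>+ z. difference_function f z \<partial>lebesgue)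
    \<le> 2 ^ DIM('a) * (\<integral>\<^sup>+ x. f x \<partial>lebesgue)"
    (is "?D \<le> _ * ?I")
proof -
  obtain g where g [measurable]: "g \<in> borel_measurable borel" and fg: "AE x in lborel. f x = g x"
    using completion_ex_borel_measurable_real[OF log_concave_borel_measurable_lebesgue[OF f]]
    by auto
  have I: "?I = (\<integral>\<^sup>+ x. g x \<partial>lborel)"
    unfolding nn_integral_completion using fg by (intro nn_integral_cong_AE) auto
  consider "?I = 0" | "?I = \<infinity>" | "?I \<noteq> 0" "?I \<noteq> \<infinity>"
    by blast
  then show ?thesis
  proof cases
    case 1
    have "?D = (\<integral>\<^sup>+ z. 0 \<partial>(lebesgue :: 'a measure))"
      by (intro nn_integral_cong_AE difference_function_AE_eq_0 f 1)
    then show ?thesis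
      by simp
  next
    case 2
    then show ?thesis
      by (simp add: ennreal_mult_top)
  next
    case 3
    define G where "G z = (\<integral>\<^sup>+ u. ennreal (g u) * ennreal (g (u - z)) \<partial>lborel)" for z
    have [measurable]: "G \<in> borel_measurable borel"
      unfolding G_def by measurable
    have "?I * difference_function f z \<le> 2 ^ DIM('a) * G z" for z
      using difference_function_le_autocorrelation[OF f g fg] by (simp add: I G_def)
    \<comment> \<open>Dividing by \<open>?I\<close> in \<open>ennreal\<close> is legitimate because
      it is neither 0 nor infinite.\<close>
    then have "difference_function f z \<le> 2 ^ DIM('a) / ?I * G z" for z
      using 3 by (metis ennreal_divide_times ennreal_times_divide infinity_ennreal_def
          mult.commute mult_divide_eq_ennreal divide_right_mono_ennreal)
    \<comment> \<open>\<open>nn_integral\<close> is a supremum over simple functions below the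
      integrand, hence monotone for arbitrary integrands; measurability is asked only of the
      majorant \<open>G\<close>.\<close>
    then have "?D \<le> (\<integral>\<^sup>+ z. 2 ^ DIM('a) / ?I * G z \<partial>lborel)"
      unfolding nn_integral_completion by (intro nn_integral_mono)
    also have "\<dots> = 2 ^ DIM('a) / ?I * ?I\<^sup>2"
      unfolding I G_def
      by (subst nn_integral_cmult)
         (simp_all add: nn_integral_autocorrelation[of "\<lambda>x. ennreal (g x)"])
    also have "\<dots> = 2 ^ DIM('a) * ?I"
      using 3 by (simp add: power2_eq_square ennreal_divide_times ennreal_divide_self
          flip: mult.assoc less_top)
    finally show ?thesis .
  qed
qed

theorem theorem1p1:
  fixes f :: "real ^ 'n \<Rightarrow> real"
  assumes "log_concave f"
  shows "(\<integral>\<^sup>+ z. difference_function f z \<partial>lebesgue)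
           \<le> 2 ^ CARD('n) * (\<integral>\<^sup>+ x. ennreal (f x) \<partial>lebesgue)"
  using nn_integral_difference_function_le[OF assms] by simp

end
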